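(* Let $m,t$ be integers with $m>0$ and $0\le t\le m$, and let $n$ be a positive integer (with $Q_{m,t}(n)$ understood for $n \bmod m$). Then: (1) if the conditions $v_2(m)\ge v_2(t)\ge 1$ are not both met, $Q_{m,t}(n)=|\mathcal{N}_{m,t,\langle n\rangle}|$. If $v_2(m)\ge v_2(t)\ge 1$, then: (2) if $v_2(n)<v_2(t)-1$, $Q_{m,t}(n)=|\mathcal{N}_{m,t,\langle n\rangle}|$; (3) if $v_2(n)=v_2(t)-1$, $Q_{m,t}(n)=|\mathcal{N}_{m,t,\langle 2n\rangle}|$; (4) if $v_2(n)\ge v_2(t)$, $Q_{m,t}(n)=|\mathcal{N}_{m,t,\langle \gcd(t,n)/2\rangle}|$.
   Context: $Q_{m,t}(n)$ is the number of $t$-element subsets of $\mathbb{Z}/m\mathbb{Z}$ whose elements sum to $n$ in $\mathbb{Z}/m\mathbb{Z}$. A bi-color necklace is an arrangement of beads colored black or white on a cycle, considered up to rotation. The frequency of a necklace with $m$ beads is the largest positive integer $u$ such that the necklace can be cut into $u$ contiguous segments all having the same ordered pattern of black and white beads (so an all-black or all-white necklace has frequency $m$). For a positive integer $k$, $\mathcal{N}_{m,t,\langle k\rangle}$ is the set of bi-color necklaces with $t$ black beads and $m-t$ white beads whose frequency divides $k$. $v_2$ is the 2-adic valuation, with $v_2(0)=+\infty$. *)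

theory Defs
  imports "HOL-Number_Theory.Number_Theory" "HOL-Library.Extended_Nat"
begin

text \<open>\<open>\<int>/m\<int>\<close> is represented by its residues \<open>{0..<m}\<close>, for \<open>m > 0\<close>. The value of
  \<open>subset_sum_count m t n\<close> depends only on the class of \<open>n\<close> modulo \<open>m\<close>.\<close>

definition subset_sum_count :: "nat \<Rightarrow> nat \<Rightarrow> nat \<Rightarrow> nat" where
  "subset_sum_count m t n =
     card {S. S \<subseteq> {0..<m} \<and> card S = t \<and> [\<Sum>S = n] (mod m)}"

datatype bead = Black | White

definition rotation_rel :: "(bead list \<times> bead list) set" where
  "rotation_rel = {(xs, ys). \<exists>k. ys = rotate k xs}"

lemma equiv_rotation_rel: "equiv UNIV rotation_rel"
proof (rule equivI)
  show "rotation_rel \<subseteq> UNIV \<times> UNIV" by simp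
  show "refl rotation_rel"
    unfolding refl_on_def rotation_rel_def by (auto intro: exI[of _ 0])
  show "sym rotation_rel"
  proof (rule symI)
    fix xs ys assume "(xs, ys) \<in> rotation_rel"
    then obtain k where k: "ys = rotate k xs" by (auto simp: rotation_rel_def)
    show "(ys, xs) \<in> rotation_rel"
    proof (cases "xs = []")
      case True
      then show ?thesis using k by (auto simp: rotation_rel_def)
    next
      case False
      define l where "l = length xs - k mod length xs"
      have "k mod length xs \<le> length xs"
        using False by (simp add: less_imp_le)
      then have "(l + k mod length xs) mod length xs = 0"
        by (simp add: l_def)
      then have "(l + k) mod length xs = 0"
        by (simp add: mod_simps)
      then have "xs = rotate l ys"
        using k by (simp add: rotate_rotate rotate_id)
      then show ?thesis by (auto simp: rotation_rel_def)
    qed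
  qed
  show "trans rotation_rel"
    by (rule transI) (auto simp: rotation_rel_def rotate_rotate)
qed

definition necklaces :: "nat \<Rightarrow> nat \<Rightarrow> bead list set set" where
  "necklaces m t =
     {xs. length xs = m \<and> count_list xs Black = t} // rotation_rel"

text \<open>The members of a necklace are the lists read off by cutting the cycle at one of its beads,
  so a necklace can be cut into \<open>u\<close> segments with the same ordered pattern \<open>w\<close>
  iff one of its members is the \<open>u\<close>-fold repetition of \<open>w\<close>. \<open>Max\<close> is meaningful
  for necklaces with at least one bead: then \<open>w\<close> is nonempty and \<open>u\<close> is at most the
  number of beads.\<close>

definition frequency :: "bead list set \<Rightarrow> nat" where
  "frequency N = Max {u. u > 0 \<and> (\<exists>w. concat (replicate u w) \<in> N)}"

definition necklaces_freq_dvd :: "nat \<Rightarrow> nat \<Rightarrow> nat \<Rightarrow> bead list set set" where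
  "necklaces_freq_dvd m t k = {N \<in> necklaces m t. frequency N dvd k}"

text \<open>The library has \<open>multiplicity 2 0 = 0\<close>, whereas here the valuation of \<open>0\<close> is infinite.\<close>

definition v2 :: "nat \<Rightarrow> enat" where
  "v2 a = (if a = 0 then \<infinity> else enat (multiplicity 2 a))"

end

theory Submission
  imports Defs "HOL-Library.Real_Mod" "HOL-Computational_Algebra.Polynomial"
begin

text \<open>Both counts are multiplicities of a character of \<open>\<int>/m\<int>\<close>. Let \<open>w\<close> be a primitive \<open>m\<close>-th root
  of unity. Fourier inversion writes \<open>m * Q(n)\<close> as the sum over \<open>j\<close> of \<open>w\<close> to the power \<open>-j n\<close>
  times the \<open>t\<close>-th elementary symmetric polynomial in the powers of \<open>w ^ j\<close>. Since the product of
  \<open>1 + x z ^ a\<close> over \<open>a < m\<close> is \<open>(1 - (-x) ^ d) ^ (m / d)\<close> when \<open>z\<close> has order \<open>d\<close>, this symmetric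
  polynomial is, up to the sign \<open>(-1) ^ (t + t / d)\<close>, the number of words fixed by rotation by \<open>j\<close>.
  Exchanging the sums leaves, for each word whose necklace has frequency \<open>u\<close>, a geometric sum over
  its stabiliser, which is the subgroup of order \<open>u\<close>; it equals \<open>u\<close> or \<open>0\<close>. So \<open>Q(n)\<close> counts the
  necklaces whose frequency satisfies a divisibility condition in \<open>n\<close> and \<open>t\<close>, which the 2-adic
  valuations turn into the four cases.\<close>

subsection \<open>Rotations of words\<close>

text \<open>Comparing prefixes of length \<open>length w\<close> shows that a nonempty power count
  \<open>v\<close> forces \<open>ys\<close> to start with \<open>w\<close>; cancelling this copy
  leaves a shorter list that again commutes with \<open>w\<close>.\<close>

lemma commute_imp_concat_replicate:
  assumes "w @ ys = ys @ w" and "length ys = v * length w"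
  shows "ys = concat (replicate v w)"
  using assms
proof (induction v arbitrary: ys)
  case (Suc v)
  then have "take (length w) ys = w"
    by (metis append_eq_append_conv_if append_eq_conv_conj le_add1 mult_Suc)
  then obtain zs where zs: "ys = w @ zs"
    by (metis append_take_drop_id)
  then show ?case
    using Suc.IH[of zs] Suc.prems by simp
qed simp

text \<open>Rotation by \<open>p\<close> swaps the prefix of length \<open>p\<close> with the rest,
  so the word is fixed iff the two parts commute.\<close>

lemma rotate_eq_self_iff_concat_replicate:
  assumes "length xs = v * p"
  shows "rotate p xs = xs \<longleftrightarrow> xs = concat (replicate v (take p xs))"
proof (cases v)
  case 0
  then show ?thesis using assms by simp
next
  case (Suc v')
  define w ys where "w = take p xs" and "ys = drop p xs"
  have len: "length w = p" "length ys = v' * length w"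
    using assms Suc by (auto simp: w_def ys_def)
  have xs: "xs = w @ ys" by (simp add: w_def ys_def)
  have "rotate p xs = ys @ w"
    using rotate_append[of w ys] len xs by simp
  moreover have "w @ concat (replicate k w) = concat (replicate k w) @ w" for k
    by (induction k) auto
  ultimately show ?thesis
    using commute_imp_concat_replicate[of w ys v'] len Suc xs
    by (metis append.assoc append_same_eq concat.simps(2) replicate_Suc same_append_eq w_def)
qed

lemma count_list_concat_replicate:
  "count_list (concat (replicate u w)) x = u * count_list w x"
  by (induction u) auto

lemma length_concat_replicate: "length (concat (replicate u w)) = u * length w"
  by (induction u) auto

lemma count_list_rotate: "count_list (rotate k xs) x = count_list xs x"
  by (metis append_take_drop_id count_list_append rotate_drop_take add.commute)

section \<open>Stabilisers of words and the frequency of a necklace\<close>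

definition rotation_period :: "'a list \<Rightarrow> nat" where
  "rotation_period xs = (LEAST p. p > 0 \<and> rotate p xs = xs)"

lemma rotation_period:
  assumes "xs \<noteq> []"
  shows rotation_period_pos: "rotation_period xs > 0"
    and rotate_rotation_period: "rotate (rotation_period xs) xs = xs"
  using LeastI[of "\<lambda>p. p > 0 \<and> rotate p xs = xs" "length xs"] assms
  by (auto simp: rotation_period_def rotate_id)

text \<open>Division with remainder: \<open>j\<close> acts like its remainder modulo the period, and
  minimality of the period lets only the remainder 0 fix the word.\<close>

lemma rotate_eq_self_iff_period_dvd:
  assumes "xs \<noteq> []"
  shows "rotate j xs = xs \<longleftrightarrow> rotation_period xs dvd j"
proof -
  let ?p = "rotation_period xs"
  have "rotate (j mod ?p) xs = rotate j xs"
    using funpow_mod_eq[of ?p rotate1 xs j] rotate_rotation_period[OF assms]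
    by (simp add: rotate_def)
  moreover have "j mod ?p = 0" if "rotate (j mod ?p) xs = xs"
  proof (rule ccontr)
    assume "j mod ?p \<noteq> 0"
    then have "?p \<le> j mod ?p"
      using that unfolding rotation_period_def by (intro Least_le) auto
    then show False
      using rotation_period_pos[OF assms] by (simp flip: not_less)
  qed
  moreover have "rotate (j mod ?p) xs = xs" if "j mod ?p = 0"
    using that by simp
  ultimately show ?thesis
    unfolding dvd_eq_mod_eq_0 by metis
qed

lemma rotation_period_dvd_length:
  assumes "xs \<noteq> []"
  shows "rotation_period xs dvd length xs"
  using rotate_eq_self_iff_period_dvd[OF assms, of "length xs"] by simp

lemma rotation_class: "rotation_rel `` {xs} = range (\<lambda>k. rotate k xs)"
  by (auto simp: rotation_rel_def)

lemma rotate_left_cancel: "rotate k xs = rotate k ys \<longleftrightarrow> xs = ys"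
proof -
  have "rotate1 xs = rotate1 ys \<longleftrightarrow> xs = ys" for xs ys :: "'a list"
    by (cases xs; cases ys) auto
  then show ?thesis
    by (induction k) simp_all
qed

text \<open>Orbit and stabiliser: shifts below the period reach the whole class, and two of them
  with the same effect would differ by a multiple of the period.\<close>

lemma card_rotation_class:
  assumes "xs \<noteq> []"
  shows "card (rotation_rel `` {xs}) = rotation_period xs"
proof -
  let ?p = "rotation_period xs"
  have "rotate k xs \<in> (\<lambda>k. rotate k xs) ` {..<?p}" for k
    using funpow_mod_eq[of ?p rotate1 xs k] rotation_period[OF assms]
    by (intro image_eqI[of _ _ "k mod ?p"]) (auto simp: rotate_def)
  then have "rotation_rel `` {xs} = (\<lambda>k. rotate k xs) ` {..<?p}"
    unfolding rotation_class by blast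
  moreover have "inj_on (\<lambda>k. rotate k xs) {..<?p}"
  proof (rule linorder_inj_onI')
    fix i j assume ij: "i \<in> {..<?p}" "j \<in> {..<?p}" "i < j"
    then have "\<not> rotate (j - i) xs = xs"
      using rotate_eq_self_iff_period_dvd[OF assms, of "j - i"] nat_dvd_not_less[of "j - i" ?p]
      by auto
    then show "rotate i xs \<noteq> rotate j xs"
      using ij rotate_left_cancel[of i xs "rotate (j - i) xs"] by (auto simp: rotate_rotate)
  qed
  ultimately show ?thesis
    by (simp add: card_image)
qed

text \<open>If some rotation is the \<open>u\<close>-fold power of \<open>w\<close>, the period
  divides \<open>length w\<close>, which bounds \<open>u\<close>; cutting \<open>xs\<close> itself
  into blocks of one period attains the bound.\<close>

lemma frequency_rotation_class:
  assumes "xs \<noteq> []"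
  shows "frequency (rotation_rel `` {xs}) = length xs div rotation_period xs"
  unfolding frequency_def
proof (rule Max_eqI)
  let ?p = "rotation_period xs"
  let ?F = "{u. u > 0 \<and> (\<exists>w. concat (replicate u w) \<in> rotation_rel `` {xs})}"
  have p: "?p > 0" "?p dvd length xs"
    using assms rotation_period_pos rotation_period_dvd_length by auto
  show le: "u \<le> length xs div ?p" if "u \<in> ?F" for u
  proof -
    from that obtain w k where u: "u > 0" and w: "concat (replicate u w) = rotate k xs"
      by (auto simp: rotation_class)
    then have len: "length xs = u * length w"
      by (metis length_concat_replicate length_rotate)
    have "take (length w) (concat (replicate u w)) = w"
      using u by (cases u) auto
    then have "rotate (length w) (rotate k xs) = rotate k xs"
      using rotate_eq_self_iff_concat_replicate[of "rotate k xs" u "length w"] w len by simp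
    \<comment> \<open>Rotations commute, so all members of a class have the same stabiliser.\<close>
    then have "rotate (length w) xs = xs"
      by (metis rotate_left_cancel rotate_rotate add.commute)
    then have "?p dvd length w"
      using rotate_eq_self_iff_period_dvd[OF assms] by blast
    then have "length xs div ?p = u * (length w div ?p)" and "length w div ?p \<noteq> 0"
      using len p(1) assms by (auto simp: div_mult_swap dvd_div_eq_0_iff)
    then show ?thesis by simp
  qed
  show "finite ?F"
    by (rule finite_subset[of _ "{..length xs div ?p}"]) (use le in auto)
  have "xs = concat (replicate (length xs div ?p) (take ?p xs))"
    using rotate_eq_self_iff_concat_replicate[of xs "length xs div ?p" ?p] p
      rotate_rotation_period[OF assms] by simp
  moreover have "xs \<in> rotation_rel `` {xs}"
    by (auto simp: rotation_class intro: image_eqI[of _ _ 0])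
  moreover have "length xs div ?p > 0"
    using assms p by (auto simp: div_greater_zero_iff dvd_imp_le)
  ultimately show "length xs div ?p \<in> ?F"
    by (auto intro: exI[of _ "take ?p xs"])
qed

lemma length_div_period_dvd_count_list:
  assumes "xs \<noteq> []"
  shows "length xs div rotation_period xs dvd count_list xs x"
proof -
  let ?p = "rotation_period xs"
  have "xs = concat (replicate (length xs div ?p) (take ?p xs))"
    using rotate_eq_self_iff_concat_replicate[of xs "length xs div ?p" ?p]
      rotation_period_dvd_length[OF assms] rotate_rotation_period[OF assms] by simp
  then have "count_list xs x = length xs div ?p * count_list (take ?p xs) x"
    using count_list_concat_replicate by metis
  then show ?thesis by simp
qed

section \<open>Counting words with a given number of black beads\<close>

abbreviation bead_words :: "nat \<Rightarrow> nat \<Rightarrow> bead list set" where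
  "bead_words m t \<equiv> {xs. length xs = m \<and> count_list xs Black = t}"

lemma finite_bead_words: "finite (bead_words m t)"
  by (rule finite_subset[OF _ finite_lists_length_eq[of "{Black, White}" m]])
    (auto intro: bead.exhaust)

lemma card_bead_words: "card (bead_words m t) = m choose t"
proof (induction m arbitrary: t)
  case 0
  have "bead_words 0 t = (if t = 0 then {[]} else {})" by auto
  then show ?case by (cases t) auto
next
  case (Suc m)
  have split: "bead_words (Suc m) t =
      (if t = 0 then {} else Cons Black ` bead_words m (t - 1)) \<union> Cons White ` bead_words m t"
    (is "?L = ?R")
  proof (intro equalityI subsetI)
    fix xs assume "xs \<in> ?L"
    then obtain b ys where "xs = b # ys" "length ys = m" "count_list (b # ys) Black = t"
      by (cases xs) auto
    then show "xs \<in> ?R" by (cases b) auto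
  qed (auto split: if_splits)
  show ?case
    unfolding split using Suc.IH finite_bead_words
    by (cases t; subst card_Un_disjoint) (auto simp: card_image simp del: One_nat_def)
qed

text \<open>A word fixed by rotation by \<open>j\<close> is a power of its prefix of length \<open>gcd j m\<close>.\<close>

lemma card_rotation_fixed_words:
  assumes "m > 0"
  defines "d \<equiv> \<lambda>j. m div gcd j m"
  shows "card {xs \<in> bead_words m t. rotate j xs = xs} =
    (if d j dvd t then gcd j m choose (t div d j) else 0)"
proof -
  define g where "g = gcd j m"
  have m: "m = d j * g" and d0: "d j > 0"
    using assms by (auto simp: g_def d_def div_greater_zero_iff)
  have fixed: "rotate j xs = xs \<longleftrightarrow> xs = concat (replicate (d j) (take g xs))"
    if "length xs = m" for xs :: "bead list"
  proof -
    have "xs \<noteq> []" using that assms by auto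
    \<comment> \<open>The period divides \<open>m\<close>, hence it divides \<open>j\<close> iff it
      divides \<open>gcd j m\<close>.\<close>
    then have "rotate j xs = xs \<longleftrightarrow> rotate g xs = xs"
      using rotate_eq_self_iff_period_dvd[of xs] rotation_period_dvd_length[of xs] that
      by (auto simp: g_def)
    then show ?thesis
      using rotate_eq_self_iff_concat_replicate[of xs "d j" g] that m by simp
  qed
  have take: "take (length w) (concat (replicate (d j) w)) = w" for w :: "bead list"
    using d0 by (cases "d j") auto
  have "{xs \<in> bead_words m t. rotate j xs = xs} =
      (\<lambda>w. concat (replicate (d j) w)) ` {w. length w = g \<and> d j * count_list w Black = t}"
    (is "?L = ?f ` ?R")
  proof (intro equalityI subsetI)
    fix xs assume xs: "xs \<in> ?L"
    then have eq: "xs = ?f (take g xs)"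
      using fixed[of xs] by auto
    have "length (take g xs) = g"
      using xs m d0 by (cases "d j") auto
    moreover have "d j * count_list (take g xs) Black = t"
      using xs eq count_list_concat_replicate[of "d j" "take g xs" Black] by auto
    ultimately show "xs \<in> ?f ` ?R"
      using eq by blast
  next
    fix xs assume "xs \<in> ?f ` ?R"
    then obtain w where w: "xs = ?f w" "length w = g" "d j * count_list w Black = t" by auto
    then have "length xs = m" "count_list xs Black = t"
      using m by (auto simp: length_concat_replicate count_list_concat_replicate)
    then show "xs \<in> ?L"
      using fixed[of xs] w take[of w] by simp
  qed
  moreover have "inj_on ?f ?R"
  proof (rule inj_onI)
    fix v w assume "v \<in> ?R" "w \<in> ?R" "?f v = ?f w"
    then show "v = w" using take[of v] take[of w] by simp
  qed
  moreover have "?R = (if d j dvd t then bead_words g (t div d j) else {})"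
    using d0 by auto
  ultimately show ?thesis
    by (simp add: card_image card_bead_words g_def)
qed

subsection \<open>Products over roots of unity\<close>

text \<open>Both sides have degree at most \<open>d\<close> and agree at \<open>d + 1\<close>
  points: they are 1 at 0 and vanish at the \<open>d\<close> distinct points
  \<open>- (inverse z ^ a)\<close>.\<close>

lemma prod_linear_roots_of_unity:
  fixes z :: "'a :: field"
  assumes "d > 0" and prim: "\<And>k. z ^ k = 1 \<longleftrightarrow> d dvd k"
  shows "(\<Prod>a<d. [:1, z ^ a:]) = 1 + monom (- ((- 1) ^ d)) d"
proof -
  let ?R = "(\<lambda>a. - (inverse z ^ a)) ` {..<d}"
  have z0: "z \<noteq> 0"
    using prim[of d] assms(1) by (auto simp: power_0_left)
  have "inj_on (\<lambda>a. - (inverse z ^ a)) {..<d}"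
  proof (rule linorder_inj_onI')
    fix i j assume ij: "i \<in> {..<d}" "j \<in> {..<d}" "i < j"
    have "z ^ (j - i) \<noteq> 1"
      using prim[of "j - i"] ij nat_dvd_not_less[of "j - i" d] by auto
    then have "z ^ j \<noteq> z ^ i"
      using z0 ij by (simp add: power_diff)
    then show "- (inverse z ^ i) \<noteq> - (inverse z ^ j)"
      by (simp add: power_inverse)
  qed
  then have card: "card (insert 0 ?R) = Suc d"
    using z0 by (subst card_insert_disjoint) (auto simp: card_image)
  show ?thesis
  proof (rule poly_eqI_degree[of "insert 0 ?R"])
    fix x assume "x \<in> insert 0 ?R"
    then consider "x = 0" | a where "a < d" "x = - (inverse z ^ a)" by auto
    then show "poly (\<Prod>a<d. [:1, z ^ a:]) x = poly (1 + monom (- ((- 1) ^ d)) d) x"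
    proof cases
      case 1
      then show ?thesis using assms(1) by (simp add: poly_prod poly_monom power_0_left)
    next
      case 2
      have "poly (\<Prod>a<d. [:1, z ^ a:]) x = 0"
        using 2 z0 by (auto simp: poly_prod power_inverse intro!: bexI[of _ a])
      moreover have "z ^ (a * d) = 1"
        using prim[of "a * d"] by simp
      then have "x ^ d = (- 1) ^ d"
        using 2 by (metis inverse_1 mult.right_neutral power_inverse power_minus power_mult)
      then have "poly (1 + monom (- ((- 1) ^ d)) d) x = 0"
        by (simp add: poly_monom flip: power_mult_distrib)
      ultimately show ?thesis by simp
    qed
  next
    have "degree (\<Prod>a<d. [:1, z ^ a:]) \<le> (\<Sum>a<d. degree [:1, z ^ a:])"
      using degree_prod_sum_le[of "{..<d}" "\<lambda>a. [:1, z ^ a:]"] by (simp add: o_def)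
    also have "\<dots> \<le> d"
      using sum_bounded_above[of "{..<d}" "\<lambda>a. degree [:1, z ^ a:]" 1] by simp
    finally show "degree (\<Prod>a<d. [:1, z ^ a:]) < card (insert 0 ?R)"
      by (simp add: card)
  next
    have "degree (1 + monom (- ((- 1) ^ d)) d :: 'a poly) \<le> d"
      by (intro degree_add_le) (auto intro: degree_monom_le)
    then show "degree (1 + monom (- ((- 1) ^ d)) d :: 'a poly) < card (insert 0 ?R)"
      by (simp add: card)
  qed
qed

lemma coeff_one_plus_monom_power:
  fixes c :: "'a :: comm_ring_1"
  assumes "d > 0"
  shows "coeff ((1 + monom c d) ^ g) t =
    (if d dvd t then of_nat (g choose (t div d)) * c ^ (t div d) else 0)"
proof -
  have "(1 + monom c d) ^ g = (monom c d + 1) ^ g"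
    by (simp add: add.commute)
  also have "\<dots> = (\<Sum>k\<le>g. monom (of_nat (g choose k) * c ^ k) (d * k))"
    unfolding binomial_ring
    by (intro sum.cong) (simp_all add: monom_power of_nat_monom mult_monom)
  finally have "coeff ((1 + monom c d) ^ g) t =
      (\<Sum>k\<le>g. if d * k = t then of_nat (g choose k) * c ^ k else 0)"
    by (simp add: coeff_sum)
  \<comment> \<open>Only \<open>k = t div d\<close> can contribute; if it exceeds \<open>g\<close>,
    the sum is empty and the binomial coefficient is 0 as well.\<close>
  also have "\<dots> = (\<Sum>k\<in>(if d dvd t then {t div d} \<inter> {..g} else {}). of_nat (g choose k) * c ^ k)"
    using assms by (intro sum.mono_neutral_cong_right) (auto split: if_splits)
  also have "\<dots> = (if d dvd t then of_nat (g choose (t div d)) * c ^ (t div d) else 0)"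
    by (auto simp: Int_insert_left binomial_eq_0)
  finally show ?thesis .
qed

text \<open>The powers of \<open>z\<close> repeat with period \<open>d\<close>, so the product is
  the \<open>g\<close>-th power of the product over one period.\<close>

lemma coeff_prod_powers:
  fixes z :: "'a :: field"
  assumes "d > 0" and prim: "\<And>k. z ^ k = 1 \<longleftrightarrow> d dvd k"
  shows "coeff (\<Prod>a<g * d. [:1, z ^ a:]) t =
    (if d dvd t then of_nat (g choose (t div d)) * (- 1) ^ (t + t div d) else 0)"
proof -
  have zd: "z ^ d = 1" using prim[of d] by simp
  have "(\<Prod>a<g * d. [:1, z ^ a:]) = (\<Prod>i<g. \<Prod>a\<in>{i * d..<i * d + d}. [:1, z ^ a:])"
    by (simp add: prod.nat_group)
  also have "\<dots> = (\<Prod>i<g. \<Prod>a<d. [:1, z ^ a:])"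
  proof (rule prod.cong)
    fix i
    have "z ^ (i * d) = 1" using prim[of "i * d"] by simp
    then show "(\<Prod>a\<in>{i * d..<i * d + d}. [:1, z ^ a:]) = (\<Prod>a<d. [:1, z ^ a:])"
      using prod.shift_bounds_nat_ivl[of "\<lambda>a. [:1, z ^ a:]" 0 "i * d" d]
      by (simp add: power_add add.commute atLeast0LessThan)
  qed simp
  also have "\<dots> = (1 + monom (- ((- 1) ^ d)) d) ^ g"
    using prod_linear_roots_of_unity[OF assms] by simp
  finally have *: "(\<Prod>a<g * d. [:1, z ^ a:]) = (1 + monom (- ((- 1) ^ d)) d) ^ g" .
  have "(- ((- 1) ^ d)) ^ (t div d) = (- 1 :: 'a) ^ (t + t div d)" if "d dvd t"
  proof -
    have "(- ((- 1) ^ d)) ^ (t div d) = (- 1 :: 'a) ^ (Suc d * (t div d))"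
      by (subst power_mult) simp
    also have "Suc d * (t div d) = t + t div d"
      using that by simp
    finally show ?thesis .
  qed
  then show ?thesis
    using assms(1) unfolding * by (simp add: coeff_one_plus_monom_power)
qed

text \<open>Expanding the product, the choice of the linear terms at the positions in
  \<open>S\<close> contributes the monomial of degree \<open>card S\<close> with coefficient
  \<open>z ^ (\<Sum>S)\<close>.\<close>

lemma coeff_prod_powers_eq_sum_subsets:
  fixes z :: "'a :: comm_ring_1"
  shows "coeff (\<Prod>a<m. [:1, z ^ a:]) t =
    (\<Sum>S | S \<subseteq> {0..<m} \<and> card S = t. z ^ (\<Sum>S))"
proof -
  have "(\<Prod>a<m. [:1, z ^ a:]) = (\<Prod>a<m. monom (z ^ a) 1 + 1)"
    by (intro prod.cong) (auto simp: monom_Suc monom_0 one_pCons)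
  also have "\<dots> = (\<Sum>S\<in>Pow {..<m}. \<Prod>a\<in>S. monom (z ^ a) 1)"
    by (subst prod_add) auto
  also have "\<dots> = (\<Sum>S\<in>Pow {..<m}. monom (z ^ (\<Sum>S)) (card S))"
  proof (rule sum.cong)
    fix S :: "nat set"
    assume "S \<in> Pow {..<m}"
    then have "finite S" by (auto intro: finite_subset)
    then show "(\<Prod>a\<in>S. monom (z ^ a) 1) = monom (z ^ (\<Sum>S)) (card S)"
      by (induction S rule: finite_induct) (auto simp: mult_monom power_add one_poly_eq_simps)
  qed simp
  finally have "coeff (\<Prod>a<m. [:1, z ^ a:]) t =
      (\<Sum>S\<in>Pow {..<m}. if card S = t then z ^ (\<Sum>S) else 0)"
    by (simp add: coeff_sum)
  also have "\<dots> = (\<Sum>S | S \<subseteq> {0..<m} \<and> card S = t. z ^ (\<Sum>S))"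
    by (intro sum.mono_neutral_cong_right) (auto simp: atLeast0LessThan)
  finally show ?thesis .
qed

section \<open>Roots of unity: geometric sums, orders of powers, existence\<close>

lemma sum_powers_root_of_unity:
  fixes z :: "'a :: field"
  assumes "z ^ m = 1"
  shows "(\<Sum>j<m. z ^ j) = (if z = 1 then of_nat m else 0)"
  using assms by (simp add: sum_gp_strict)

text \<open>After division by \<open>gcd j m\<close> the remaining factor of \<open>j\<close> is
  coprime to that of \<open>m\<close> and can be cancelled. This gives the order of
  \<open>w ^ j\<close> that \<open>coeff_prod_powers\<close> asks for.\<close>

lemma primitive_root_of_unity_power:
  fixes w :: "'a :: monoid_mult"
  assumes "m > 0" and "\<And>k. w ^ k = 1 \<longleftrightarrow> m dvd k"
  shows "(w ^ j) ^ k = 1 \<longleftrightarrow> m div gcd j m dvd k"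
proof -
  have "gcd j m > 0" using assms(1) by simp
  then obtain j' m' where "j = gcd j m * j'" "m = gcd j m * m'" "coprime j' m'"
    by (metis gcd_coprime_exists gr_implies_not0 mult.commute)
  then have "m dvd j * k \<longleftrightarrow> m div gcd j m dvd k"
    by (metis \<open>gcd j m > 0\<close> coprime_commute coprime_dvd_mult_right_iff dvd_mult_cancel1
        mult.assoc nat_mult_dvd_cancel1 nonzero_mult_div_cancel_left not_gr_zero)
  then show ?thesis
    using assms(2) by (simp flip: power_mult)
qed

lemma ex_primitive_root_of_unity:
  assumes "m > 0"
  obtains w :: complex where "\<And>k. w ^ k = 1 \<longleftrightarrow> m dvd k"
proof
  fix k
  have "cis (2 * pi / m) ^ k = 1 \<longleftrightarrow> (\<exists>n :: int. real k * (2 * pi / m) = n * (2 * pi))"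
    by (simp add: Complex.DeMoivre cis_eq_1_iff)
  also have "\<dots> \<longleftrightarrow> (\<exists>n :: int. real_of_int (int k) = real_of_int (n * int m))"
    using assms by (intro ex_cong1) (auto simp: field_simps)
  also have "\<dots> \<longleftrightarrow> int m dvd int k"
    unfolding of_int_eq_iff by (auto simp: dvd_def mult.commute)
  finally show "cis (2 * pi / m) ^ k = 1 \<longleftrightarrow> m dvd k" by simp
qed

subsection \<open>Character sums over stabilisers\<close>

text \<open>The generator of a stabiliser of order \<open>u\<close> permutes the black positions in \<open>t div u\<close> cycles of
  length \<open>u\<close>, a permutation of sign \<open>(-1) ^ (t + t div u)\<close>; the condition says that the character
  \<open>n\<close> takes this value at the generator.\<close>

definition wedge_compatible :: "nat \<Rightarrow> nat \<Rightarrow> nat \<Rightarrow> bool" where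
  "wedge_compatible t n u \<longleftrightarrow>
     (if even (t + t div u) then u dvd n else u dvd 2 * n \<and> \<not> u dvd n)"

text \<open>On the shifts \<open>p * i\<close> with \<open>i < u\<close> the sign is itself a
  character of \<open>i\<close>, so the summands are the powers of one number \<open>q\<close> with
  \<open>q ^ u = 1\<close>. The sum is \<open>u\<close> or 0 according to whether
  \<open>q = 1\<close>.\<close>

lemma stabiliser_character_sum:
  fixes w :: complex
  assumes "m > 0" and w: "\<And>k. w ^ k = 1 \<longleftrightarrow> m dvd k"
    and m: "m = p * u" and "u dvd t"
  shows "(\<Sum>j | j < m \<and> p dvd j. w ^ (j * ((m - 1) * n)) * (- 1) ^ (t + t div (m div gcd j m))) =
    (if wedge_compatible t n u then of_nat u else 0)"
proof -
  obtain s where t: "t = u * s" using assms by blast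
  have pu: "p > 0" "u > 0" using assms by auto
  define e :: complex where "e = (- 1) ^ (t + s)"
  define q where "q = w ^ (p * ((m - 1) * n)) * e"
  have sgn: "(- 1) ^ (t + t div (m div gcd (p * i) m)) = e ^ i" for i
  proof -
    have "m div gcd (p * i) m = u div gcd i u"
      using pu m by (simp add: gcd_mult_distrib_nat[symmetric])
    moreover have "t div (u div gcd i u) = s * gcd i u"
    proof -
      obtain v where "u = gcd i u * v" by (meson dvdE gcd_dvd2)
      moreover from this have "v > 0" "gcd i u > 0" using pu by (auto intro: gr0I)
      ultimately show ?thesis
        using t by (metis mult.assoc mult.commute nonzero_mult_div_cancel_left not_gr_zero)
    qed
    \<comment> \<open>If \<open>s\<close> is even, so is \<open>t\<close>, and both sides hold. If
      \<open>s\<close> is odd, \<open>t\<close> has the parity of \<open>u\<close>: for odd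
      \<open>u\<close> the gcd is odd and both sides hold, for even \<open>u\<close> the gcd has the
      parity of \<open>i\<close>.\<close>
    moreover have "even (t + s * gcd i u) \<longleftrightarrow> even ((t + s) * i)"
      using t by auto
    ultimately show ?thesis
      unfolding e_def by (metis neg_one_even_power neg_one_odd_power power_mult)
  qed
  have "(\<Sum>j | j < m \<and> p dvd j. w ^ (j * ((m - 1) * n)) * (- 1) ^ (t + t div (m div gcd j m))) =
      (\<Sum>i<u. w ^ (p * i * ((m - 1) * n)) * (- 1) ^ (t + t div (m div gcd (p * i) m)))"
  proof (rule sum.reindex_cong[of "\<lambda>i. p * i"])
    show "{j. j < m \<and> p dvd j} = (\<lambda>i. p * i) ` {..<u}"
      using pu m by auto
  qed (use pu in \<open>auto intro: inj_onI\<close>)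
  also have "\<dots> = (\<Sum>i<u. q ^ i)"
    unfolding sgn
    by (intro sum.cong) (simp_all add: q_def power_mult_distrib ac_simps flip: power_mult)
  also have "\<dots> = (if q = 1 then of_nat u else 0)"
  proof (rule sum_powers_root_of_unity)
    have "e ^ u = 1"
    proof -
      \<comment> \<open>The product is \<open>s * u * (u + 1)\<close>, with two consecutive
        factors.\<close>
      have "even ((t + s) * u)" using t by auto
      then show ?thesis by (simp add: e_def flip: power_mult)
    qed
    moreover have "w ^ (p * ((m - 1) * n) * u) = 1"
      using w m by auto
    ultimately show "q ^ u = 1"
      by (simp add: q_def power_mult_distrib flip: power_mult)
  qed
  also have "q = 1 \<longleftrightarrow> wedge_compatible t n u"
  proof -
    have "w ^ (p * ((m - 1) * n)) * w ^ (p * n) = w ^ (m * (p * n))"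
      using \<open>m > 0\<close> by (cases m) (simp_all add: algebra_simps flip: power_add)
    also have "\<dots> = 1" using w by simp
    finally have 1: "w ^ (p * ((m - 1) * n)) * w ^ (p * n) = 1" .
    \<comment> \<open>By \<open>1\<close>, \<open>q\<close> is the quotient of \<open>e\<close> by
      \<open>w ^ (p * n)\<close>.\<close>
    have "q = 1 \<longleftrightarrow> w ^ (p * n) = e"
    proof
      assume "q = 1"
      then have "w ^ (p * n) = w ^ (p * n) * q" by simp
      also have "\<dots> = w ^ (p * ((m - 1) * n)) * w ^ (p * n) * e"
        by (simp only: q_def ac_simps)
      finally show "w ^ (p * n) = e" unfolding 1 by simp
    qed (use 1 in \<open>simp add: q_def\<close>)
    moreover have dvd: "w ^ (p * k) = 1 \<longleftrightarrow> u dvd k" for k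
      using w m pu by simp
    \<comment> \<open>A complex number is -1 iff its square is 1 and it is not 1 itself;
      \<open>w ^ p\<close> has order \<open>u\<close>.\<close>
    have "w ^ (p * n) = - 1 \<longleftrightarrow> u dvd 2 * n \<and> \<not> u dvd n"
    proof -
      have "w ^ (p * (2 * n)) = (w ^ (p * n))\<^sup>2"
        by (simp flip: power_mult add: ac_simps)
      then have "u dvd 2 * n \<longleftrightarrow> w ^ (p * n) = 1 \<or> w ^ (p * n) = - 1"
        using dvd[of "2 * n"] by (simp add: power2_eq_1_iff)
      then show ?thesis using dvd[of n] by auto
    qed
    ultimately show ?thesis
      using dvd[of n] t pu by (auto simp: wedge_compatible_def e_def)
  qed
  finally show ?thesis .
qed

text \<open>\<open>(m - 1) * n\<close> plays the role of \<open>-n\<close> modulo \<open>m\<close>, so that all exponents are natural numbers.\<close>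

lemma nat_cong_iff_dvd_add:
  fixes a m n :: nat
  assumes "m > 0"
  shows "[a = n] (mod m) \<longleftrightarrow> m dvd a + (m - 1) * n"
proof -
  have "[a = n] (mod m) \<longleftrightarrow> [a + (m - 1) * n = n + (m - 1) * n] (mod m)"
    by (simp add: cong_add_rcancel_nat)
  also have "n + (m - 1) * n = m * n"
    using assms by (cases m) auto
  finally show ?thesis
    by (metis cong_0_iff cong_mult_self_left cong_sym cong_trans)
qed

text \<open>Each word is weighted by the frequency \<open>u\<close> of its necklace, so that the
  \<open>m div u\<close> words of a necklace together weigh \<open>m\<close>. This matches the
  factor \<open>m\<close> that Fourier inversion puts on the left.\<close>

lemma subset_sum_count_character_sum:
  fixes w :: complex
  assumes "m > 0" and w: "\<And>k. w ^ k = 1 \<longleftrightarrow> m dvd k"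
  shows "(of_nat (subset_sum_count m t n * m) :: complex) =
    (\<Sum>xs\<in>bead_words m t. if wedge_compatible t n (m div rotation_period xs)
       then of_nat (m div rotation_period xs) else 0)"
proof -
  let ?N = "(m - 1) * n"
  let ?T = "{S. S \<subseteq> {0..<m} \<and> card S = t}"
  let ?c = "\<lambda>j. w ^ (j * ?N) * (- 1) ^ (t + t div (m div gcd j m))"
  have "(of_nat (subset_sum_count m t n * m) :: complex) =
      (\<Sum>S\<in>?T. if [\<Sum>S = n] (mod m) then of_nat m else 0)"
  proof -
    have "finite ?T" by (rule finite_subset[of _ "Pow {0..<m}"]) auto
    moreover have "{S. S \<subseteq> {0..<m} \<and> card S = t \<and> [\<Sum>S = n] (mod m)} =
        ?T \<inter> {S. [\<Sum>S = n] (mod m)}" by auto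
    ultimately show ?thesis
      by (simp add: subset_sum_count_def sum.If_cases)
  qed
  also have "\<dots> = (\<Sum>S\<in>?T. \<Sum>j<m. w ^ (j * ?N) * (w ^ j) ^ \<Sum>S)"
  proof (rule sum.cong)
    fix S :: "nat set"
    let ?k = "\<Sum>S + ?N"
    have "(\<Sum>j<m. (w ^ ?k) ^ j) = (if w ^ ?k = 1 then of_nat m else 0)"
      using w by (intro sum_powers_root_of_unity) (simp flip: power_mult)
    also have "w ^ ?k = 1 \<longleftrightarrow> [\<Sum>S = n] (mod m)"
      using w nat_cong_iff_dvd_add[OF assms(1)] by simp
    also have "(\<Sum>j<m. (w ^ ?k) ^ j) = (\<Sum>j<m. w ^ (j * ?N) * (w ^ j) ^ \<Sum>S)"
      by (intro sum.cong) (simp_all add: algebra_simps flip: power_mult power_add)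
    finally show "(if [\<Sum>S = n] (mod m) then of_nat m else 0) =
        (\<Sum>j<m. w ^ (j * ?N) * (w ^ j) ^ \<Sum>S)" by simp
  qed simp
  also have "\<dots> = (\<Sum>j<m. w ^ (j * ?N) * (\<Sum>S\<in>?T. (w ^ j) ^ \<Sum>S))"
    by (subst sum.swap) (simp add: sum_distrib_left)
  \<comment> \<open>The inner sum is a coefficient of the product over the powers of
    \<open>w ^ j\<close>, of order \<open>?d\<close>. Up to sign it is the binomial coefficient that
    counts the words fixed by \<open>j\<close>.\<close>
  also have "\<dots> = (\<Sum>j<m. ?c j * of_nat (card {xs \<in> bead_words m t. rotate j xs = xs}))"
  proof (rule sum.cong)
    fix j
    let ?d = "m div gcd j m"
    have "m = gcd j m * ?d" and "?d > 0"
      using assms(1) by (auto simp: div_greater_zero_iff)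
    then have "(\<Sum>S\<in>?T. (w ^ j) ^ \<Sum>S) =
        (if ?d dvd t then of_nat (gcd j m choose (t div ?d)) * (- 1) ^ (t + t div ?d) else 0)"
      using coeff_prod_powers[OF _ primitive_root_of_unity_power[OF assms], of j "gcd j m" t]
      by (simp add: coeff_prod_powers_eq_sum_subsets)
    then show "w ^ (j * ?N) * (\<Sum>S\<in>?T. (w ^ j) ^ \<Sum>S) =
        ?c j * of_nat (card {xs \<in> bead_words m t. rotate j xs = xs})"
      using card_rotation_fixed_words[OF assms(1), of t j] by simp
  qed simp
  also have "\<dots> = (\<Sum>j<m. \<Sum>xs\<in>bead_words m t. if rotate j xs = xs then ?c j else 0)"
  proof (rule sum.cong)
    fix j
    have "{xs \<in> bead_words m t. rotate j xs = xs} = bead_words m t \<inter> {xs. rotate j xs = xs}"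
      by auto
    then show "?c j * of_nat (card {xs \<in> bead_words m t. rotate j xs = xs}) =
        (\<Sum>xs\<in>bead_words m t. if rotate j xs = xs then ?c j else 0)"
      by (simp add: sum.If_cases finite_bead_words)
  qed simp
  also have "\<dots> = (\<Sum>xs\<in>bead_words m t. \<Sum>j<m. if rotate j xs = xs then ?c j else 0)"
    by (rule sum.swap)
  also have "\<dots> = (\<Sum>xs\<in>bead_words m t. if wedge_compatible t n (m div rotation_period xs)
       then of_nat (m div rotation_period xs) else 0)"
  proof (rule sum.cong)
    fix xs assume xs: "xs \<in> bead_words m t"
    let ?p = "rotation_period xs"
    have "xs \<noteq> []" using xs assms(1) by auto
    have "(\<Sum>j<m. if rotate j xs = xs then ?c j else 0) = (\<Sum>j | j < m \<and> ?p dvd j. ?c j)"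
      using rotate_eq_self_iff_period_dvd[OF \<open>xs \<noteq> []\<close>]
      by (intro sum.mono_neutral_cong_right) auto
    also have "\<dots> = (if wedge_compatible t n (m div ?p) then of_nat (m div ?p) else 0)"
      using rotation_period_dvd_length[OF \<open>xs \<noteq> []\<close>]
        length_div_period_dvd_count_list[OF \<open>xs \<noteq> []\<close>, of Black] xs
      by (intro stabiliser_character_sum[OF assms]) auto
    finally show "(\<Sum>j<m. if rotate j xs = xs then ?c j else 0) =
        (if wedge_compatible t n (m div ?p) then of_nat (m div ?p) else 0)" .
  qed simp
  finally show ?thesis .
qed

section \<open>From words to necklaces\<close>

lemma rotation_class_subset_bead_words:
  assumes "xs \<in> bead_words m t"
  shows "rotation_rel `` {xs} \<subseteq> bead_words m t"
  using assms by (auto simp: rotation_class count_list_rotate)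

text \<open>This confines the later comparison of divisibility conditions to common divisors of
  \<open>m\<close> and \<open>t\<close>.\<close>

lemma frequency_dvd:
  assumes "m > 0" and "N \<in> necklaces m t"
  shows "frequency N dvd m" and "frequency N dvd t"
proof -
  obtain xs where xs: "xs \<in> bead_words m t" "N = rotation_rel `` {xs}"
    using assms(2) by (auto simp: necklaces_def elim: quotientE)
  then have "xs \<noteq> []" using assms(1) by auto
  then show "frequency N dvd m" "frequency N dvd t"
    using frequency_rotation_class[of xs] rotation_period_dvd_length[of xs]
      length_div_period_dvd_count_list[of xs Black] xs
    by auto
qed

text \<open>Grouping the weighted sum over words by rotation classes, a compatible necklace
  contributes its size times its frequency, which is \<open>m\<close>, and any other contributes 0;
  then \<open>m\<close> cancels.\<close>

lemma subset_sum_count_eq_card_necklaces: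
  assumes "m > 0"
  shows "subset_sum_count m t n = card {N \<in> necklaces m t. wedge_compatible t n (frequency N)}"
proof -
  obtain w :: complex where w: "\<And>k. w ^ k = 1 \<longleftrightarrow> m dvd k"
    using ex_primitive_root_of_unity[OF assms] by blast
  let ?f = "\<lambda>xs :: bead list. if wedge_compatible t n (m div rotation_period xs)
       then m div rotation_period xs else 0"
  have fin: "finite (necklaces m t)"
    unfolding necklaces_def quotient_def by (simp add: finite_bead_words)
  have "of_nat (subset_sum_count m t n * m) = (of_nat (sum ?f (bead_words m t)) :: complex)"
    unfolding subset_sum_count_character_sum[OF assms w] of_nat_sum
    by (intro sum.cong) auto
  then have "subset_sum_count m t n * m = sum ?f (bead_words m t)"
    unfolding of_nat_eq_iff .
  also have "bead_words m t = \<Union>(necklaces m t)"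
  proof
    show "bead_words m t \<subseteq> \<Union>(necklaces m t)"
      using equiv_class_self[OF equiv_rotation_rel] by (auto simp: necklaces_def quotient_def)
    show "\<Union>(necklaces m t) \<subseteq> bead_words m t"
      using rotation_class_subset_bead_words by (fastforce simp: necklaces_def quotient_def)
  qed
  also have "sum ?f (\<Union>(necklaces m t)) = (\<Sum>N\<in>necklaces m t. sum ?f N)"
  proof (subst sum.Union_disjoint)
    show "\<forall>N\<in>necklaces m t. finite N"
      using finite_subset[OF rotation_class_subset_bead_words finite_bead_words]
      by (fastforce simp: necklaces_def quotient_def)
    have "N \<in> UNIV // rotation_rel" if "N \<in> necklaces m t" for N
      using that by (auto simp: necklaces_def quotient_def)
    then show "\<forall>N\<in>necklaces m t. \<forall>N'\<in>necklaces m t. N \<noteq> N' \<longrightarrow> N \<inter> N' = {}"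
      using quotient_disj[OF equiv_rotation_rel] by blast
  qed simp
  also have "\<dots> = (\<Sum>N\<in>necklaces m t. if wedge_compatible t n (frequency N) then m else 0)"
  proof (rule sum.cong)
    fix N assume "N \<in> necklaces m t"
    then obtain xs where xs: "xs \<in> bead_words m t" "N = rotation_rel `` {xs}"
      by (auto simp: necklaces_def elim: quotientE)
    have freq: "m div rotation_period ys = frequency N" "card N = rotation_period ys"
      "rotation_period ys dvd m" if "ys \<in> N" for ys
    proof -
      have "N = rotation_rel `` {ys}"
        using that xs equiv_class_eq[OF equiv_rotation_rel] by auto
      moreover have "ys \<in> bead_words m t"
        using that xs rotation_class_subset_bead_words by blast
      moreover from this have "ys \<noteq> []" using assms by auto
      ultimately show "m div rotation_period ys = frequency N" "card N = rotation_period ys"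
          "rotation_period ys dvd m"
        using frequency_rotation_class card_rotation_class rotation_period_dvd_length by auto
    qed
    have "sum ?f N = (\<Sum>ys\<in>N. if wedge_compatible t n (frequency N) then frequency N else 0)"
      using freq(1) by (intro sum.cong) auto
    moreover have "xs \<in> N"
      using xs equiv_class_self[OF equiv_rotation_rel] by auto
    then have "card N * frequency N = m"
      using freq[of xs] by (metis dvd_mult_div_cancel)
    ultimately show "sum ?f N = (if wedge_compatible t n (frequency N) then m else 0)"
      by simp
  qed simp
  also have "\<dots> = card {N \<in> necklaces m t. wedge_compatible t n (frequency N)} * m"
    using fin by (simp add: sum.If_cases Int_def)
  finally show ?thesis
    using assms by simp
qed

subsection \<open>Two-adic valuations\<close>

lemma odd_part:
  assumes "a > 0"
  obtains b where "a = 2 ^ multiplicity 2 a * b" and "odd (b :: nat)"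
  using assms multiplicity_decompose'[of a 2] by auto

text \<open>A power of two is coprime to every odd number, so the two parts are compared
  separately.\<close>

lemma two_power_mult_dvd_iff:
  fixes x y :: nat
  assumes "odd x" "odd y"
  shows "2 ^ i * x dvd 2 ^ j * y \<longleftrightarrow> i \<le> j \<and> x dvd y"
proof
  assume *: "2 ^ i * x dvd 2 ^ j * y"
  have "coprime (2 ^ i) y" "coprime x (2 ^ j)"
    using assms by simp_all
  moreover have "2 ^ i dvd 2 ^ j * y" "x dvd 2 ^ j * y"
    using * by (auto dest: dvd_mult_left dvd_mult_right)
  ultimately have "2 ^ i dvd (2 ^ j :: nat)" "x dvd y"
    by (simp_all add: coprime_dvd_mult_left_iff coprime_dvd_mult_right_iff)
  then show "i \<le> j \<and> x dvd y"
    by (simp add: power_dvd_imp_le dvd_power_iff_le)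
qed (auto intro: mult_dvd_mono le_imp_power_dvd)

lemma odd_div_iff_multiplicity:
  fixes u t :: nat
  assumes "u dvd t" "t > 0"
  shows "odd (t div u) \<longleftrightarrow> multiplicity 2 u = multiplicity 2 t"
proof -
  obtain s where s: "t = u * s" using assms by blast
  then have "multiplicity 2 t = multiplicity 2 u + multiplicity 2 s"
    using assms by (simp add: prime_elem_multiplicity_mult_distrib)
  moreover have "odd s \<longleftrightarrow> multiplicity 2 s = 0"
    using s assms multiplicity_eq_zero_iff[of s 2] by auto
  ultimately show ?thesis
    using s assms by auto
qed

text \<open>The sign is -1 exactly when \<open>t\<close> is even and \<open>t div u\<close> is odd,
  that is, when \<open>b = a\<close> and \<open>a \<ge> 1\<close>. Beyond divisibility of odd parts,
  the condition is then \<open>b = Suc c\<close> instead of \<open>b \<le> c\<close>.\<close>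

lemma wedge_compatible_iff:
  fixes t n u :: nat
  assumes "u dvd t" "t > 0" "n > 0"
  defines "a \<equiv> multiplicity 2 t" and "c \<equiv> multiplicity 2 n" and "b \<equiv> multiplicity 2 u"
  shows "\<not> (b = a \<and> a \<ge> 1) \<Longrightarrow> wedge_compatible t n u \<longleftrightarrow> u dvd n"
    and "c + 1 < a \<Longrightarrow> wedge_compatible t n u \<longleftrightarrow> u dvd n"
    and "c + 1 = a \<Longrightarrow> wedge_compatible t n u \<longleftrightarrow> u dvd 2 * n"
    and "a \<ge> 1 \<Longrightarrow> a \<le> c \<Longrightarrow> wedge_compatible t n u \<longleftrightarrow> u dvd gcd t n div 2"
proof -
  have "u > 0" using assms by (auto intro: gr0I)
  obtain t' where t: "t = 2 ^ a * t'" "odd t'" using odd_part[OF \<open>t > 0\<close>] a_def by metis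
  obtain n' where n: "n = 2 ^ c * n'" "odd n'" using odd_part[OF \<open>n > 0\<close>] c_def by metis
  obtain u' where u: "u = 2 ^ b * u'" "odd u'" using odd_part[OF \<open>u > 0\<close>] b_def by metis
  have ut: "b \<le> a" "u' dvd t'"
    using assms(1) t u two_power_mult_dvd_iff by auto
  have dn: "u dvd n \<longleftrightarrow> b \<le> c \<and> u' dvd n'"
    using n u two_power_mult_dvd_iff by auto
  have "2 * n = 2 ^ Suc c * n'" using n by simp
  then have d2n: "u dvd 2 * n \<longleftrightarrow> b \<le> Suc c \<and> u' dvd n'"
    using n u two_power_mult_dvd_iff by metis
  have "even t \<longleftrightarrow> a \<ge> 1" using t by (cases a) auto
  moreover have "odd (t div u) \<longleftrightarrow> b = a"
    using odd_div_iff_multiplicity[OF assms(1,2)] by (simp add: a_def b_def)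
  ultimately have wc: "wedge_compatible t n u \<longleftrightarrow>
      (if b = a \<and> a \<ge> 1 then b = Suc c \<and> u' dvd n' else b \<le> c \<and> u' dvd n')"
    using dn d2n ut by (auto simp: wedge_compatible_def)
  \<comment> \<open>If \<open>c + 1 < a\<close>, both sides fail at \<open>b = a\<close>. If
    \<open>c + 1 = a\<close>, the bounds on \<open>b\<close> hold automatically, also at
    \<open>b = a\<close>, and only \<open>u' dvd n'\<close> remains.\<close>
  show "\<not> (b = a \<and> a \<ge> 1) \<Longrightarrow> wedge_compatible t n u \<longleftrightarrow> u dvd n"
    and "c + 1 < a \<Longrightarrow> wedge_compatible t n u \<longleftrightarrow> u dvd n"
    and "c + 1 = a \<Longrightarrow> wedge_compatible t n u \<longleftrightarrow> u dvd 2 * n"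
    using wc dn d2n ut by auto
  show "wedge_compatible t n u \<longleftrightarrow> u dvd gcd t n div 2" if "a \<ge> 1" "a \<le> c"
  proof -
    have "even t" "even n" using t n that by simp_all
    then have "even (gcd t n)" by simp
    \<comment> \<open>Halving the gcd amounts to doubling \<open>u\<close>, which raises its 2-adic
      valuation by one and so rules out \<open>b = a\<close>.\<close>
    then have "u dvd gcd t n div 2 \<longleftrightarrow> 2 * u dvd gcd t n"
      by (auto simp: dvd_div_iff_mult mult.commute)
    also have "2 * u = 2 ^ Suc b * u'" using u by simp
    also have "2 ^ Suc b * u' dvd gcd t n \<longleftrightarrow> 2 ^ Suc b * u' dvd t \<and> 2 ^ Suc b * u' dvd n"
      by (rule gcd_greatest_iff)
    also have "2 ^ Suc b * u' dvd t \<longleftrightarrow> Suc b \<le> a \<and> u' dvd t'"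
      unfolding t(1) by (rule two_power_mult_dvd_iff[OF u(2) t(2)])
    also have "2 ^ Suc b * u' dvd n \<longleftrightarrow> Suc b \<le> c \<and> u' dvd n'"
      unfolding n(1) by (rule two_power_mult_dvd_iff[OF u(2) n(2)])
    finally show ?thesis using wc that ut by auto
  qed
qed

section \<open>The four cases by 2-adic valuation\<close>

theorem theorem3:
  fixes m t n :: nat
  assumes "m > 0" and "t \<le> m" and "n > 0"
  shows "(\<not> (v2 m \<ge> v2 t \<and> v2 t \<ge> 1) \<longrightarrow>
            subset_sum_count m t n = card (necklaces_freq_dvd m t n)) \<and>
         (v2 m \<ge> v2 t \<and> v2 t \<ge> 1 \<longrightarrow>
            (v2 n < v2 t - 1 \<longrightarrow>
               subset_sum_count m t n = card (necklaces_freq_dvd m t n)) \<and>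
            (v2 n = v2 t - 1 \<longrightarrow>
               subset_sum_count m t n = card (necklaces_freq_dvd m t (2 * n))) \<and>
            (v2 n \<ge> v2 t \<longrightarrow>
               subset_sum_count m t n = card (necklaces_freq_dvd m t (gcd t n div 2))))"
proof -
  have count: "subset_sum_count m t n = card (necklaces_freq_dvd m t k)"
    if "\<And>u. u dvd m \<Longrightarrow> u dvd t \<Longrightarrow> wedge_compatible t n u \<longleftrightarrow> u dvd k" for k
  proof -
    have "{N \<in> necklaces m t. wedge_compatible t n (frequency N)} = necklaces_freq_dvd m t k"
      using that frequency_dvd[OF assms(1)] by (auto simp: necklaces_freq_dvd_def)
    then show ?thesis
      using subset_sum_count_eq_card_necklaces[OF assms(1)] by simp
  qed
  show ?thesis
  proof (cases "t = 0")
    case True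
    \<comment> \<open>Here \<open>v2 t\<close> is infinite and \<open>v2 m\<close> finite, so the
      first case applies; the sign exponent is 0.\<close>
    then have "\<not> v2 m \<ge> v2 t" using assms by (simp add: v2_def)
    moreover have "subset_sum_count m t n = card (necklaces_freq_dvd m t n)"
      using True by (intro count) (simp add: wedge_compatible_def)
    ultimately show ?thesis by simp
  next
    case False
    then have pos: "t > 0" by simp
    have val: "v2 m = multiplicity 2 m" "v2 t = multiplicity 2 t" "v2 n = multiplicity 2 n"
      using pos assms by (simp_all add: v2_def)
    \<comment> \<open>If the valuation of \<open>t\<close> exceeds that of \<open>m\<close>, no
      divisor of \<open>m\<close> reaches it, so the sign -1 never occurs.\<close>
    have le: "multiplicity 2 u \<le> multiplicity 2 m" if "u dvd m" for u
      using that assms by (simp add: dvd_imp_multiplicity_le)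
    note iff = wedge_compatible_iff[OF _ pos \<open>n > 0\<close>]
    let ?M = "multiplicity 2 m" and ?T = "multiplicity 2 t" and ?C = "multiplicity 2 n"
    have "subset_sum_count m t n = card (necklaces_freq_dvd m t n)"
      if "\<not> (?T \<le> ?M \<and> 1 \<le> ?T)"
      by (rule count, rule iff(1)) (use that in \<open>auto dest: le\<close>)
    moreover have "subset_sum_count m t n = card (necklaces_freq_dvd m t n)" if "?C < ?T - 1"
      by (rule count, rule iff(2)) (use that in auto)
    \<comment> \<open>With \<open>1 \<le> ?T\<close> the truncated subtraction is exact, so the
      assumption says \<open>?C + 1 = ?T\<close>.\<close>
    moreover have "subset_sum_count m t n = card (necklaces_freq_dvd m t (2 * n))"
      if "1 \<le> ?T" "?C = ?T - 1"
      by (rule count, rule iff(3)) (use that in auto)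
    moreover have "subset_sum_count m t n = card (necklaces_freq_dvd m t (gcd t n div 2))"
      if "1 \<le> ?T" "?T \<le> ?C"
      by (rule count, rule iff(4)) (use that in auto)
    ultimately show ?thesis
      unfolding val one_enat_def idiff_enat_enat enat_ord_simps enat.inject by blast
  qed
qed

end
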